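(* Let $j$ and $k$ be non-negative integers with $k\geq j$, and let $G$ be a graph with girth at least $2j+3$. Then $$\zeta_k(G)\leq \gamma_j(G)+\Delta_j(G).$$
   Context: Graphs are finite, connected, without parallel edges (loops are irrelevant and ignored for girth; an acyclic graph has infinite girth). $\gamma_j(G)$ is the minimum size of a $j$-dominating set of $G$, i.e. a set $S\subseteq V(G)$ such that every vertex $x\notin S$ is at distance at most $j$ from some vertex of $S$. $\Delta_j(G)$ is the maximum, over $u\in V(G)$, of the number of vertices within distance $j$ of $u$ (including $u$ itself). The $k$-visibility Localization game on a finite connected graph $G$ ($k\ge 0$ an integer) with $m$ cops: the robber first chooses a vertex of $G$. Then in each round the cops choose any vertices $u_1,\dots,u_m$ (no restriction relative to earlier placements), and cop $i$ receives the probe $d_i=d(u_i,x)$ if the robber's vertex $x$ satisfies $d(u_i,x)\le k$, and $d_i=\ast$ (no information) otherwise; afterwards the robber moves to a neighboring vertex or stays in place. A candidate is a vertex the robber may occupy, consistent with the information obtained so far. The cops win if they have a strategy that, whatever the robber does, determines after finitely many rounds a unique candidate (the robber is omniscient and knows the cops' entire strategy). The $k$-visibility localization number $\zeta_k(G)$ is the least positive integer $m$ for which $m$ cops have a winning strategy. *)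

theory Defs
  imports "HOL-Library.Extended_Nat" "Graph_Theory.Graph_Theory"
begin

text \<open>
  An undirected graph is a symmetric digraph: an edge is a pair of opposite arcs. Finite undirected
  graphs without parallel edges, with loops permitted, are the digraphs satisfying
  \<^locale>\<open>pseudo_graph\<close> and \<^locale>\<open>nomulti_digraph\<close>.
\<close>

section \<open>Distance, girth, domination\<close>

text \<open>The value is meaningful only if there is a walk from \<open>u\<close> to \<open>v\<close>.\<close>

definition graph_dist :: "('a, 'b) pre_digraph \<Rightarrow> 'a \<Rightarrow> 'a \<Rightarrow> nat" where
  "graph_dist G u v = (LEAST n. \<exists>p. pre_digraph.awalk G u p v \<and> length p = n)"

lemma (in wf_digraph) graph_dist_conv_mu:
  assumes "u \<rightarrow>\<^sup>* v"
  shows "\<mu> (\<lambda>_. 1) u v = ereal (real (graph_dist G u v))"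
proof -
  have cost: "awalk_cost (\<lambda>_. 1) p = real (length p)" for p
    by (induction p) auto
  have ex: "\<exists>n p. awalk u p v \<and> length p = n"
    using assms reachable_awalk by auto
  obtain p where p: "awalk u p v" "length p = graph_dist G u v"
    using LeastI_ex[OF ex] unfolding graph_dist_def by auto
  have le: "graph_dist G u v \<le> length q" if "awalk u q v" for q
    unfolding graph_dist_def by (rule Least_le) (use that in auto)
  show ?thesis
    unfolding \<mu>_def cost
  proof (rule antisym)
    show "(INF q\<in>{q. awalk u q v}. ereal (real (length q))) \<le> ereal (real (graph_dist G u v))"
      by (rule INF_lower2[of p]) (use p in auto)
    show "ereal (real (graph_dist G u v)) \<le> (INF q\<in>{q. awalk u q v}. ereal (real (length q)))"
      by (rule INF_greatest) (use le in auto)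
  qed
qed

text \<open>
  For a symmetric digraph, a loop and the traversal of one edge back and forth satisfy
  \<^const>\<open>pre_digraph.cycle\<close> with lengths 1 and 2. Neither counts for the girth; without parallel
  edges, the remaining ones are the cycles of the underlying simple graph. For an acyclic graph the
  infimum is over the empty set, hence infinite.
\<close>

definition girth :: "('a, 'b) pre_digraph \<Rightarrow> enat" where
  "girth G = (INF c \<in> {c. pre_digraph.cycle G c \<and> 3 \<le> length c}. enat (length c))"

definition dominating_set :: "('a, 'b) pre_digraph \<Rightarrow> nat \<Rightarrow> 'a set \<Rightarrow> bool" where
  "dominating_set G j S \<longleftrightarrow>
     S \<subseteq> verts G \<and> (\<forall>x \<in> verts G - S. \<exists>s \<in> S. graph_dist G s x \<le> j)"

definition domination_number :: "('a, 'b) pre_digraph \<Rightarrow> nat \<Rightarrow> nat" where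
  "domination_number G j = Min (card ` {S. dominating_set G j S})"

definition max_ball_size :: "('a, 'b) pre_digraph \<Rightarrow> nat \<Rightarrow> nat" where
  "max_ball_size G j = Max ((\<lambda>u. card {v \<in> verts G. graph_dist G u v \<le> j}) ` verts G)"


section \<open>The limited-visibility Localization game\<close>

definition probe :: "('a, 'b) pre_digraph \<Rightarrow> nat \<Rightarrow> 'a \<Rightarrow> 'a \<Rightarrow> nat option" where
  "probe G k u x = (if graph_dist G u x \<le> k then Some (graph_dist G u x) else None)"

text \<open>
  Everything the cops learn is the list, round by round, of the probe results of all cops. A cop
  strategy computes the next placement, given as a list with one entry per cop, from the
  results of the earlier rounds. As it is deterministic, the earlier placements
  can be recovered from these results, so they need not be passed as an argument.
\<close>

type_synonym 'a cop_strategy = "nat option list list \<Rightarrow> 'a list"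

definition legal_strategy :: "('a, 'b) pre_digraph \<Rightarrow> nat \<Rightarrow> 'a cop_strategy \<Rightarrow> bool" where
  "legal_strategy G m \<sigma> \<longleftrightarrow> (\<forall>h. length (\<sigma> h) = m \<and> set (\<sigma> h) \<subseteq> verts G)"

text \<open>\<open>x t\<close> is the robber's vertex when the cops probe in round \<open>t\<close>, counted from 0.\<close>

definition robber_walk :: "('a, 'b) pre_digraph \<Rightarrow> (nat \<Rightarrow> 'a) \<Rightarrow> bool" where
  "robber_walk G x \<longleftrightarrow> x 0 \<in> verts G \<and> (\<forall>t. x (Suc t) = x t \<or> x t \<rightarrow>\<^bsub>G\<^esub> x (Suc t))"

text \<open>The probe results of the first \<open>t\<close> rounds.\<close>

primrec history ::
  "('a, 'b) pre_digraph \<Rightarrow> nat \<Rightarrow> 'a cop_strategy \<Rightarrow> (nat \<Rightarrow> 'a) \<Rightarrow> nat \<Rightarrow> nat option list list" where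
  "history G k \<sigma> x 0 = []"
| "history G k \<sigma> x (Suc t) =
     history G k \<sigma> x t @ [map (\<lambda>u. probe G k u (x t)) (\<sigma> (history G k \<sigma> x t))]"

text \<open>The candidates after the probes of round \<open>t\<close>, before the robber's next move.\<close>

definition candidates ::
  "('a, 'b) pre_digraph \<Rightarrow> nat \<Rightarrow> 'a cop_strategy \<Rightarrow> (nat \<Rightarrow> 'a) \<Rightarrow> nat \<Rightarrow> 'a set" where
  "candidates G k \<sigma> x t =
     {y t |y. robber_walk G y \<and> history G k \<sigma> y (Suc t) = history G k \<sigma> x (Suc t)}"

text \<open>
  The omniscient robber knows the whole strategy in advance, so his counter-play
  amounts to an arbitrary walk.
\<close>

definition cops_win :: "('a, 'b) pre_digraph \<Rightarrow> nat \<Rightarrow> nat \<Rightarrow> bool" where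
  "cops_win G k m \<longleftrightarrow>
     (\<exists>\<sigma>. legal_strategy G m \<sigma> \<and>
        (\<forall>x. robber_walk G x \<longrightarrow> (\<exists>t v. candidates G k \<sigma> x t = {v})))"

definition localization_number :: "('a, 'b) pre_digraph \<Rightarrow> nat \<Rightarrow> nat" where
  "localization_number G k = (LEAST m. 1 \<le> m \<and> cops_win G k m)"

text \<open>One cop on every vertex wins, so this minimum exists for all nonempty finite connected graphs.\<close>

lemma (in fin_digraph) cops_win_card_verts:
  assumes reach: "\<And>u v. u \<in> verts G \<Longrightarrow> v \<in> verts G \<Longrightarrow> u \<rightarrow>\<^sup>* v"
  shows "cops_win G k (card (verts G))"
proof -
  obtain vs where vs: "set vs = verts G" "distinct vs"
    using finite_distinct_list[OF finite_verts] by blast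
  have self: "graph_dist G u u = 0" if "u \<in> verts G" for u
    unfolding graph_dist_def by (rule Least_eq_0) (use that in \<open>auto simp: awalk_Nil_iff\<close>)
  have pos: "u = v" if "u \<in> verts G" "v \<in> verts G" "graph_dist G u v = 0" for u v
  proof -
    have "\<exists>n p. awalk u p v \<and> length p = n"
      using reach[OF that(1,2)] reachable_awalk by auto
    then have "\<exists>p. awalk u p v \<and> length p = graph_dist G u v"
      unfolding graph_dist_def by (rule LeastI_ex)
    then show ?thesis using that by (auto simp: awalk_Nil_iff)
  qed
  have "candidates G k (\<lambda>_. vs) x 0 = {x 0}" if x: "robber_walk G x" for x
  proof -
    have "y 0 = x 0" if y: "robber_walk G y"
      and eq: "history G k (\<lambda>_. vs) y (Suc 0) = history G k (\<lambda>_. vs) x (Suc 0)" for y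
    proof -
      have v: "x 0 \<in> verts G" "y 0 \<in> verts G"
        using x y by (auto simp: robber_walk_def)
      then have "probe G k (x 0) (y 0) = probe G k (x 0) (x 0)"
        using eq vs by (auto simp: map_eq_conv)
      then have "graph_dist G (x 0) (y 0) = 0"
        using self[OF v(1)] by (auto simp: probe_def split: if_splits)
      then show ?thesis using pos v by metis
    qed
    then show ?thesis using x unfolding candidates_def by blast
  qed
  moreover have "legal_strategy G (card (verts G)) (\<lambda>_. vs)"
    using vs distinct_card[of vs] by (auto simp: legal_strategy_def)
  ultimately show ?thesis unfolding cops_win_def by blast
qed

end

theory Submission
  imports Defs
begin

text \<open>
  The cops always probe a minimum \<open>j\<close>-dominating set \<open>S\<close>, and in addition the ball of radius \<open>j\<close>
  around a vertex \<open>s\<close> of \<open>S\<close> that was nearest to the robber in the previous round. If the robber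
  was at distance less than \<open>j\<close> from \<open>s\<close>, he is still inside this ball and is probed directly.
  So after two consecutive rounds of escaping, he has moved from \<open>x\<close> to a neighbour \<open>y\<close>, where both
  are at distance exactly \<open>j\<close> from \<open>S\<close>. As \<open>x\<close> was among the probed vertices, every candidate is a
  neighbour of \<open>x\<close> with the same distance \<open>j\<close> as \<open>y\<close> to some \<open>s \<in> S\<close>, while \<open>x\<close> itself is not
  closer to \<open>s\<close>. Two such candidates would close a cycle of length at most \<open>2 j + 2\<close> through \<open>x\<close>.
\<close>

section \<open>Distance\<close>

locale connected_pseudo_graph = pseudo_graph +
  assumes connected: "connected G"
begin

lemma reachable_verts: "u \<in> verts G \<Longrightarrow> v \<in> verts G \<Longrightarrow> u \<rightarrow>\<^sup>* v"
  using symmetric_connected_imp_strongly_connected[OF sym_arcs connected] by auto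

lemma graph_dist_le: "awalk u p v \<Longrightarrow> graph_dist G u v \<le> length p"
  unfolding graph_dist_def by (rule Least_le) auto

lemma geodesic:
  assumes "u \<in> verts G" "v \<in> verts G"
  obtains p where "awalk u p v" "length p = graph_dist G u v"
proof -
  have "\<exists>n p. awalk u p v \<and> length p = n"
    using reachable_verts[OF assms] reachable_awalk by auto
  then have "\<exists>p. awalk u p v \<and> length p = graph_dist G u v"
    unfolding graph_dist_def by (rule LeastI_ex)
  then show ?thesis using that by blast
qed

lemma graph_dist_self: "u \<in> verts G \<Longrightarrow> graph_dist G u u = 0"
  using graph_dist_le[of u "[]" u] by (simp add: awalk_Nil_iff)

lemma graph_dist_eq_0:
  assumes "u \<in> verts G" "v \<in> verts G" "graph_dist G u v = 0"
  shows "u = v"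
  using geodesic[OF assms(1,2)] assms(3) by (auto simp: awalk_Nil_iff)

lemma graph_dist_step:
  assumes "s \<in> verts G" "u \<rightarrow> v"
  shows "graph_dist G s v \<le> Suc (graph_dist G s u)"
proof -
  obtain p where p: "awalk s p u" "length p = graph_dist G s u"
    using geodesic assms adj_in_verts by metis
  obtain e where "e \<in> arcs G" "tail G e = u" "head G e = v"
    using assms(2) by auto
  then have "awalk s (p @ [e]) v"
    using p(1) by (auto simp: awalk_simps)
  from graph_dist_le[OF this] show ?thesis using p(2) by simp
qed

lemma graph_dist_predecessor:
  assumes "s \<in> verts G" "u \<in> verts G" "graph_dist G s u = Suc n"
  obtains w where "w \<rightarrow> u" "graph_dist G s w = n"
proof -
  obtain p where p: "awalk s p u" "length p = Suc n"
    using geodesic assms by metis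
  then obtain q e where q: "p = q @ [e]" "length q = n"
    by (metis length_Suc_conv_rev)
  have e: "awalk s q (tail G e)" "e \<in> arcs G" "head G e = u"
    using p(1) q(1) by (auto simp: awalk_simps)
  have adj: "tail G e \<rightarrow> u" using e in_arcs_imp_in_arcs_ends by metis
  have "graph_dist G s (tail G e) \<le> n" using graph_dist_le[OF e(1)] q(2) by simp
  moreover have "Suc n \<le> Suc (graph_dist G s (tail G e))"
    using graph_dist_step[OF assms(1) adj] assms(3) by simp
  ultimately show ?thesis using that adj by force
qed

lemma graph_dist_eq_1:
  assumes "u \<in> verts G" "v \<in> verts G" "graph_dist G u v = 1"
  shows "u \<rightarrow> v"
proof -
  obtain w where "w \<rightarrow> v" "graph_dist G u w = 0"
    using graph_dist_predecessor[of u v 0] assms by auto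
  then show ?thesis using graph_dist_eq_0 assms(1) adj_in_verts by metis
qed

lemma graph_dist_adj:
  assumes "u \<rightarrow> v" "u \<noteq> v"
  shows "graph_dist G u v = 1"
proof -
  have "u \<in> verts G" "v \<in> verts G" using assms adj_in_verts by auto
  then show ?thesis
    using graph_dist_step[OF _ assms(1), of u] graph_dist_eq_0[of u v] graph_dist_self assms(2)
    by force
qed


section \<open>Short cycles\<close>

text \<open>Geodesics from \<open>u\<close> and \<open>v\<close> back to \<open>s\<close> are
  followed in lockstep until they meet. That all inner vertices are closer to \<open>s\<close> keeps
  the path simple in the induction and later keeps \<open>x\<close> off it.\<close>

lemma path_between_equidistant:
  assumes "s \<in> verts G" "u \<in> verts G" "v \<in> verts G" "u \<noteq> v"
    and "graph_dist G s u = n" "graph_dist G s v = n"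
  shows "\<exists>r. apath u r v \<and> 2 \<le> length r \<and> length r \<le> 2 * n \<and>
    (\<forall>w \<in> set (awalk_verts u r). w = u \<or> w = v \<or> graph_dist G s w < n)"
  using assms
proof (induction n arbitrary: u v)
  case 0
  then show ?case using graph_dist_eq_0 by metis
next
  case (Suc n)
  obtain u' where u': "u' \<rightarrow> u" "graph_dist G s u' = n"
    using graph_dist_predecessor Suc.prems by metis
  obtain v' where v': "v' \<rightarrow> v" "graph_dist G s v' = n"
    using graph_dist_predecessor Suc.prems by metis
  have verts': "u' \<in> verts G" "v' \<in> verts G" using u' v' adj_in_verts by auto
  have "u \<rightarrow> u'" using u'(1) arcs_ends_symmetric[OF sym_arcs] by blast
  then obtain e where e: "e \<in> arcs G" "tail G e = u" "head G e = u'" by auto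
  obtain f where f: "f \<in> arcs G" "tail G f = v'" "head G f = v" using v'(1) by auto
  \<comment> \<open>The bound \<open>n\<close> covers both cases: the two geodesics have met, or the
    induction hypothesis applies to the predecessors, which are themselves at distance
    \<open>n\<close>.\<close>
  obtain r where r: "awalk u' r v'" "distinct (awalk_verts u' r)" "length r \<le> 2 * n"
    "\<forall>w \<in> set (awalk_verts u' r). graph_dist G s w \<le> n"
  proof (cases "u' = v'")
    case True
    show ?thesis
      by (rule that[of "[]"]) (use True verts' u' in \<open>auto simp: awalk_Nil_iff\<close>)
  next
    case False
    from Suc.IH[OF Suc.prems(1) verts' False u'(2) v'(2)] obtain r
      where "apath u' r v'" "length r \<le> 2 * n"
        "\<forall>w \<in> set (awalk_verts u' r). w = u' \<or> w = v' \<or> graph_dist G s w < n"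
      by blast
    then show ?thesis using that[of r] u'(2) v'(2) by (fastforce simp: apath_def)
  qed
  have "awalk v' [f] v" using f Suc.prems by (auto simp: awalk_simps)
  then have walk': "awalk u' (r @ [f]) v" using r(1) by (rule awalk_appendI[rotated])
  then have walk: "awalk u (e # r @ [f]) v"
    using e Suc.prems by (simp add: awalk_Cons_iff del: awalk_append_iff)
  from walk' have "awalk_verts u' (r @ [f]) = awalk_verts u' r @ [v]"
    using awalk_verts_append[of u' r "[f]" v] r(1) f by auto
  then have verts: "awalk_verts u (e # r @ [f]) = u # awalk_verts u' r @ [v]"
    using e by simp
  have "u \<notin> set (awalk_verts u' r)" "v \<notin> set (awalk_verts u' r)"
    using r(4) Suc.prems by fastforce+
  then have "apath u (e # r @ [f]) v"
    using walk r(2) Suc.prems(4) unfolding apath_def verts by auto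
  moreover have "\<forall>w \<in> set (awalk_verts u (e # r @ [f])). w = u \<or> w = v \<or> graph_dist G s w < Suc n"
    unfolding verts using r(4) by auto
  ultimately show ?case using r(3) by (intro exI[of _ "e # r @ [f]"]) simp
qed

text \<open>A path of length at most \<open>2 * j\<close> between distinct \<open>u\<close> and
  \<open>v\<close> would close up through \<open>x\<close> to a cycle of length at most
  \<open>2 * j + 2\<close>, below the girth.\<close>

lemma equidistant_neighbours_eq:
  assumes girth: "girth G \<ge> enat (2 * j + 3)"
    and s: "s \<in> verts G" and adj: "x \<rightarrow> u" "x \<rightarrow> v"
    and ne: "x \<noteq> u" "x \<noteq> v"
    and dist: "graph_dist G s u = j" "graph_dist G s v = j" "j \<le> graph_dist G s x"
  shows "u = v"
proof (rule ccontr)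
  assume "u \<noteq> v"
  then obtain r where r: "apath u r v" "2 \<le> length r" "length r \<le> 2 * j"
    "\<forall>w \<in> set (awalk_verts u r). w = u \<or> w = v \<or> graph_dist G s w < j"
    using path_between_equidistant[OF s _ _ _ dist(1,2)] adj adj_in_verts by metis
  obtain e where e: "e \<in> arcs G" "tail G e = x" "head G e = u" using adj(1) by auto
  have "v \<rightarrow> x" using adj(2) arcs_ends_symmetric[OF sym_arcs] by blast
  then obtain f where f: "f \<in> arcs G" "tail G f = v" "head G f = x" by auto
  have "awalk v [f] x" using f by (auto simp: awalk_simps)
  then have walk': "awalk u (r @ [f]) x"
    using r(1) unfolding apath_def by (blast intro: awalk_appendI)
  then have walk: "awalk x (e # r @ [f]) x"
    using e by (simp add: awalk_Cons_iff del: awalk_append_iff)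
  from walk' have verts: "awalk_verts u (r @ [f]) = awalk_verts u r @ [x]"
    using awalk_verts_append[of u r "[f]" x] r(1) f by (auto simp: apath_def)
  \<comment> \<open>Inner vertices of the path are nearer to \<open>s\<close> than \<open>j\<close>,
    and \<open>x\<close> is not.\<close>
  have "x \<notin> set (awalk_verts u r)"
    using r(4) ne dist(3) by fastforce
  then have "cycle (e # r @ [f])"
    using walk r(1) verts e unfolding cycle_def apath_def by (intro exI[of _ x]) simp
  then have "girth G \<le> enat (length (e # r @ [f]))"
    unfolding girth_def by (intro INF_lower) (use r(2) in auto)
  with girth have "enat (2 * j + 3) \<le> enat (length (e # r @ [f]))" by (rule order_trans)
  then show False using r(3) by simp
qed


section \<open>Domination number and ball sizes\<close>

lemma minimum_dominating_set:
  obtains S where "dominating_set G j S" "card S = domination_number G j"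
proof -
  have "{S. dominating_set G j S} \<subseteq> Pow (verts G)"
    by (auto simp: dominating_set_def)
  then have "finite {S. dominating_set G j S}"
    by (rule finite_subset) simp
  moreover have "verts G \<in> {S. dominating_set G j S}"
    by (auto simp: dominating_set_def)
  ultimately have "domination_number G j \<in> card ` {S. dominating_set G j S}"
    unfolding domination_number_def by (intro Min_in) auto
  then show ?thesis using that by force
qed

lemma card_ball_le:
  "u \<in> verts G \<Longrightarrow> card {v \<in> verts G. graph_dist G u v \<le> j} \<le> max_ball_size G j"
  unfolding max_ball_size_def by (intro Max_ge) auto

lemma dominating_set_near:
  assumes "dominating_set G j S" "x \<in> verts G"
  shows "\<exists>s \<in> S. graph_dist G s x \<le> j"
  using assms graph_dist_self[of x] unfolding dominating_set_def by (cases "x \<in> S") force+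

end

text \<open>Balls vary in size, but a strategy always places the same number of cops; the surplus
  ones are stacked on \<open>x\<close>.\<close>

lemma list_of_set_padded:
  assumes "finite A" "x \<in> A" "card A \<le> n"
  shows "\<exists>l. set l = A \<and> length l = n"
proof -
  obtain xs where xs: "set xs = A" "length xs = card A"
    using finite_distinct_list[OF assms(1)] distinct_card by metis
  show ?thesis
    using assms xs by (intro exI[of _ "xs @ replicate (n - card A) x"]) auto
qed


section \<open>The game\<close>

text \<open>Reads off a cop nearest to the robber from the probe results \<open>r\<close> alone, whose entries
  beyond the cops in \<open>ss\<close> are ignored.\<close>

definition nearest :: "'a list \<Rightarrow> nat option list \<Rightarrow> 'a" where
  "nearest ss r = ss ! (SOME i. i < length ss \<and>
     (\<exists>d. r ! i = Some d \<and> (\<forall>i' < length ss. \<forall>d'. r ! i' = Some d' \<longrightarrow> d \<le> d')))"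

lemma nearest_probe:
  assumes "s \<in> set ss" "graph_dist G s x \<le> k"
    and r: "r = map (\<lambda>u. probe G k u x) (ss @ us)"
  shows "nearest ss r \<in> set ss"
    and "\<And>s'. s' \<in> set ss \<Longrightarrow> graph_dist G (nearest ss r) x \<le> graph_dist G s' x"
proof -
  let ?P = "\<lambda>i. i < length ss \<and>
     (\<exists>d. r ! i = Some d \<and> (\<forall>i' < length ss. \<forall>d'. r ! i' = Some d' \<longrightarrow> d \<le> d'))"
  have entry: "r ! i = probe G k (ss ! i) x" if "i < length ss" for i
    using that r by (simp add: nth_append)
  obtain i0 where i0: "i0 < length ss" "ss ! i0 = s"
    using assms(1) by (auto simp: in_set_conv_nth)
  obtain i where i: "i < length ss"
    "\<And>i'. i' < length ss \<Longrightarrow> graph_dist G (ss ! i) x \<le> graph_dist G (ss ! i') x"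
    using arg_min_nat_lemma[of "\<lambda>i. i < length ss" i0 "\<lambda>i. graph_dist G (ss ! i) x"] i0(1)
    by (metis (no_types))
  \<comment> \<open>The truly nearest vertex is visible because \<open>s\<close> is, so its index
    witnesses the choice in \<open>nearest\<close>.\<close>
  have "graph_dist G (ss ! i) x \<le> k" using i(2)[OF i0(1)] i0(2) assms(2) by simp
  then have "?P i" using i entry by (auto simp: probe_def split: if_splits)
  then have "?P (SOME i. ?P i)" by (rule someI)
  then obtain m d where m: "m < length ss" "nearest ss r = ss ! m" and d: "r ! m = Some d"
      "\<forall>i' < length ss. \<forall>d'. r ! i' = Some d' \<longrightarrow> d \<le> d'"
    unfolding nearest_def by blast
  then show "nearest ss r \<in> set ss" by simp
  fix s' assume "s' \<in> set ss"
  then obtain i' where i': "i' < length ss" "ss ! i' = s'" by (auto simp: in_set_conv_nth)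
  have dist: "graph_dist G (nearest ss r) x = d" "d \<le> k"
    using m d(1) entry by (auto simp: probe_def split: if_splits)
  show "graph_dist G (nearest ss r) x \<le> graph_dist G s' x"
  \<comment> \<open>An invisible \<open>s'\<close> is farther than \<open>k\<close>, whereas the
    chosen vertex is visible.\<close>
  proof (cases "graph_dist G s' x \<le> k")
    case True
    then have "r ! i' = Some (graph_dist G s' x)" using entry i' by (auto simp: probe_def)
    then show ?thesis using d(2) i'(1) dist by auto
  next
    case False
    then show ?thesis using dist by auto
  qed
qed

text \<open>Equal histories include equal earlier rounds, hence the same placement in round
  \<open>t\<close>; only the probes of that round are then compared.\<close>

lemma candidates_eq_singleton:
  assumes "robber_walk G x"
    and "\<And>y. robber_walk G y \<Longrightarrow>
      (\<And>u. u \<in> set (\<sigma> (history G k \<sigma> x t)) \<Longrightarrow> probe G k u (y t) = probe G k u (x t)) \<Longrightarrow>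
      y t = x t"
  shows "candidates G k \<sigma> x t = {x t}"
proof -
  have "y t = x t" if y: "robber_walk G y" "history G k \<sigma> y (Suc t) = history G k \<sigma> x (Suc t)" for y
    using y by (intro assms(2)) (auto simp: map_eq_conv)
  then show ?thesis using assms(1) unfolding candidates_def by blast
qed

context connected_pseudo_graph
begin

lemma robber_walk_verts: "robber_walk G x \<Longrightarrow> x t \<in> verts G"
  by (induction t) (auto simp: robber_walk_def dest: adj_in_verts, metis adj_in_verts(2))

text \<open>Distance 0 is visible for every \<open>k\<close> and identifies the vertex.\<close>

lemma candidates_probed_vertex:
  assumes "robber_walk G x" "x t \<in> set (\<sigma> (history G k \<sigma> x t))"
  shows "candidates G k \<sigma> x t = {x t}"
proof (rule candidates_eq_singleton[OF assms(1)])
  fix y assume y: "robber_walk G y"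
    and "\<And>u. u \<in> set (\<sigma> (history G k \<sigma> x t)) \<Longrightarrow> probe G k u (y t) = probe G k u (x t)"
  then have "probe G k (x t) (y t) = probe G k (x t) (x t)" using assms(2) by blast
  then have "graph_dist G (x t) (y t) = 0"
    using graph_dist_self[OF robber_walk_verts[OF assms(1)]] by (auto simp: probe_def split: if_splits)
  then show "y t = x t"
    using graph_dist_eq_0 robber_walk_verts assms(1) y by metis
qed

text \<open>A unique candidate arises in one of the rounds 0, 1 and 2: a robber avoiding all probed
  vertices in these rounds is located in round 1.\<close>

theorem cops_win_dominating_set:
  assumes "j \<le> k" and girth: "girth G \<ge> enat (2 * j + 3)"
    and dom: "dominating_set G j S"
  shows "cops_win G k (card S + max_ball_size G j)"
proof -
  have SV: "S \<subseteq> verts G" using dom by (simp add: dominating_set_def)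
  then have "finite S" by (rule finite_subset) simp
  then obtain ss where ss: "set ss = S" "length ss = card S"
    using finite_distinct_list distinct_card by metis
  let ?ball = "\<lambda>s. {v \<in> verts G. graph_dist G s v \<le> j}"
  \<comment> \<open>Legality concerns all histories, even impossible ones, so a list of vertices of
    the right length is also provided for \<open>s\<close> outside the graph.\<close>
  have "\<exists>l. length l = max_ball_size G j \<and> set l \<subseteq> verts G \<and> (s \<in> verts G \<longrightarrow> ?ball s \<subseteq> set l)" for s
  proof -
    have *: "\<exists>l. set l = ?ball u \<and> length l = max_ball_size G j" if "u \<in> verts G" for u
      by (rule list_of_set_padded[of _ u]) (use that card_ball_le graph_dist_self in auto)
    obtain u where "u \<in> verts G"
      using connected by (auto simp: connected_def strongly_connected_def)
    with * show ?thesis by (cases "s \<in> verts G") (metis (mono_tags, lifting) mem_Collect_eq subsetI)+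
  qed
  then obtain B where B: "\<And>s. length (B s) = max_ball_size G j" "\<And>s. set (B s) \<subseteq> verts G"
    "\<And>s. s \<in> verts G \<Longrightarrow> ?ball s \<subseteq> set (B s)"
    by metis
  \<comment> \<open>In round 0 \<open>last []\<close> is unspecified, so the second group of cops
    stands at arbitrary vertices.\<close>
  define \<sigma> where "\<sigma> h = ss @ B (nearest ss (last h))" for h
  have legal: "legal_strategy G (card S + max_ball_size G j) \<sigma>"
    using ss SV B by (auto simp: legal_strategy_def \<sigma>_def)
  have "\<exists>t v. candidates G k \<sigma> x t = {v}" if x: "robber_walk G x" for x
  proof (rule ccontr)
    assume "\<not> ?thesis"
    then have uncaught: "candidates G k \<sigma> x t \<noteq> {x t}" for t by blast
    let ?cops = "\<lambda>t. set (\<sigma> (history G k \<sigma> x t))"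
    \<comment> \<open>\<open>c t\<close> is read off from the probes of round \<open>t\<close>; its
      ball is probed in round \<open>Suc t\<close>.\<close>
    define c where "c t = nearest ss (last (history G k \<sigma> x (Suc t)))" for t
    have xV: "x t \<in> verts G" for t by (rule robber_walk_verts[OF x])
    have escape: "x t \<notin> ?cops t" for t
      using candidates_probed_vertex[OF x] uncaught by blast
    have S_cops: "S \<subseteq> ?cops t" for t using ss by (auto simp: \<sigma>_def)
    have c: "c t \<in> S" "graph_dist G (c t) (x t) \<le> j"
      "s \<in> S \<Longrightarrow> graph_dist G (c t) (x t) \<le> graph_dist G s (x t)" for t s
    proof -
      obtain s0 where s0: "s0 \<in> set ss" "graph_dist G s0 (x t) \<le> j"
        using dominating_set_near[OF dom xV] ss by blast
      have r: "last (history G k \<sigma> x (Suc t)) = map (\<lambda>u. probe G k u (x t))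
          (ss @ B (nearest ss (last (history G k \<sigma> x t))))"
        by (simp add: \<sigma>_def)
      have near: "graph_dist G s0 (x t) \<le> k" using s0(2) assms(1) by simp
      show "c t \<in> S" unfolding c_def using nearest_probe(1)[OF s0(1) near r] ss by simp
      have min: "graph_dist G (c t) (x t) \<le> graph_dist G s (x t)" if "s \<in> S" for s
        unfolding c_def using nearest_probe(2)[OF s0(1) near r] ss that by blast
      show "s \<in> S \<Longrightarrow> graph_dist G (c t) (x t) \<le> graph_dist G s (x t)" by (rule min)
      show "graph_dist G (c t) (x t) \<le> j" using min[of s0] s0 ss by simp
    qed
    have cV: "c t \<in> verts G" for t using c(1) SV by blast
    have ball_cops: "?ball (c t) \<subseteq> ?cops (Suc t)" for t
      using B(3)[OF cV[of t]] unfolding \<sigma>_def c_def by auto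
    have move: "x t \<rightarrow> x (Suc t)" "x t \<noteq> x (Suc t)" for t
    proof -
      have "x t \<in> ?cops (Suc t)" using ball_cops[of t] c(2)[of t] xV[of t] by blast
      then show ne: "x t \<noteq> x (Suc t)" using escape[of "Suc t"] by metis
      then show "x t \<rightarrow> x (Suc t)" using x unfolding robber_walk_def by metis
    qed
    \<comment> \<open>The robber leaves the ball around \<open>c t\<close> in a single step, so he
      was on its boundary.\<close>
    have dist_c: "graph_dist G (c t) (x t) = j" for t
    proof -
      have "\<not> graph_dist G (c t) (x (Suc t)) \<le> j"
        using escape[of "Suc t"] ball_cops[of t] xV[of "Suc t"] by blast
      then show ?thesis using graph_dist_step[OF cV move(1), of t t] c(2)[of t] by linarith
    qed
    \<comment> \<open>This gives \<open>1 \<le> k\<close>, so that the cop on \<open>x 0\<close>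
      sees a robber one step away.\<close>
    have "0 < j"
    proof (rule ccontr)
      assume "\<not> 0 < j"
      then have "c 0 = x 0" using dist_c[of 0] graph_dist_eq_0[OF cV xV] by auto
      then show False using c(1)[of 0] S_cops[of 0] escape[of 0] by auto
    qed
    then have k: "1 \<le> k" using assms(1) by simp
    have "candidates G k \<sigma> x 1 = {x 1}"
    proof (rule candidates_eq_singleton[OF x])
      fix y assume y: "robber_walk G y"
        and eq: "\<And>u. u \<in> ?cops 1 \<Longrightarrow> probe G k u (y 1) = probe G k u (x 1)"
      have dist_eq: "graph_dist G u (y 1) = graph_dist G u (x 1)"
        if "u \<in> ?cops 1" "graph_dist G u (x 1) \<le> k" for u
        using eq[OF that(1)] that(2) by (auto simp: probe_def split: if_splits)
      have yV: "y 1 \<in> verts G" by (rule robber_walk_verts[OF y])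
      have "x 0 \<in> ?cops 1" using ball_cops[of 0] c(2)[of 0] xV[of 0] by auto
      moreover have "graph_dist G (x 0) (x 1) = 1" using graph_dist_adj move[of 0] by simp
      ultimately have one: "graph_dist G (x 0) (y 1) = 1" using dist_eq k by simp
      have "graph_dist G (c 1) (y 1) = j"
        using dist_eq[of "c 1"] S_cops[of 1] c(1)[of 1] dist_c[of 1] assms(1) by auto
      \<comment> \<open>\<open>c 0\<close> was nearest to \<open>x 0\<close>, at distance
        \<open>j\<close>, so \<open>c 1\<close> cannot be closer.\<close>
      moreover have "j \<le> graph_dist G (c 1) (x 0)" using c(3)[of "c 1" 0] c(1) dist_c[of 0] by simp
      moreover have "x 0 \<rightarrow> y 1" using graph_dist_eq_1[OF xV yV one] .
      moreover have "x 0 \<noteq> y 1" using one graph_dist_self[OF yV] by auto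
      ultimately show "y 1 = x 1"
        using equidistant_neighbours_eq[OF girth cV[of 1], of "x 0" "y 1" "x 1"] move[of 0] dist_c[of 1]
        by simp
    qed
    then show False using uncaught by blast
  qed
  with legal show ?thesis unfolding cops_win_def by blast
qed

end

theorem theorem2:
  fixes G :: "('a, 'b) pre_digraph" and j k :: nat
  assumes "pseudo_graph G" and "nomulti_digraph G" and "connected G"
    and "k \<ge> j"
    and "girth G \<ge> enat (2 * j + 3)"
  shows "localization_number G k \<le> domination_number G j + max_ball_size G j"
proof -
  interpret pseudo_graph G by fact
  interpret connected_pseudo_graph G by unfold_locales fact
  obtain S where S: "dominating_set G j S" "card S = domination_number G j"
    by (rule minimum_dominating_set)
  obtain u where u: "u \<in> verts G"
    using connected by (auto simp: connected_def strongly_connected_def)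
  then have "{v \<in> verts G. graph_dist G u v \<le> j} \<noteq> {}"
    using graph_dist_self[of u] by auto
  then have "0 < card {v \<in> verts G. graph_dist G u v \<le> j}"
    by (simp add: card_gt_0_iff)
  \<comment> \<open>\<open>localization_number\<close> ranges over positive numbers of cops
    only.\<close>
  then have "1 \<le> max_ball_size G j" using card_ball_le[OF u, of j] by simp
  moreover have "cops_win G k (domination_number G j + max_ball_size G j)"
    using cops_win_dominating_set[OF assms(4,5) S(1)] S(2) by simp
  ultimately show ?thesis
    unfolding localization_number_def by (intro Least_le) simp
qed

end
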